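(* The function $W(P,Q)=w(c_0(P),c_1(Q))$ ($P,Q\in(k)$, $P>Q$) can be identified from the first-order transition function $\psi$ by $$W(\overline P(s_0),\overline Q(s_1))=-\frac{1}{J(s_0,s_1)}\,\frac{\partial^2\psi(s_0,s_1)}{\partial s_0\,\partial s_1},\qquad s_0>s_1,$$ where $\overline P(s_0)$, $\overline Q(s_1)$ are the points of $(k)$ with arc-length parameters $s_0$, $s_1$. The original continuous weight function $w(c_0,c_1)$ can be identified, for admissible $(c_0,c_1)$, by $$w(c_0,c_1)=W(P(c_0),Q(c_1)),$$ where $P(c_0)$ is the point of intersection of $(k)$ with $\gamma_0(c_0)$ and $Q(c_1)$ is the point of intersection of $(k)$ with $\gamma_1(c_1)$.
   Context: Let $\Omega\subseteq\mathbb{R}^2$ be open. Relay operator. Let $D_0,D_1\subseteq\Omega$ be open with $D_0\cup D_1=\Omega$, with relative boundaries $(\gamma_i):=\Omega\cap\partial D_i$ that are continuous curves. For a continuous input signal $u$ with values in $\Omega$, the relay output $(Ru)(t)$ takes values in $\{0,1\}$; at the initial time, the value $i$ of the relay satisfies $u\in D_i$; $t\mapsto(Ru)(t)$ is right-continuous with left limits; its value changes exactly at the moments of exit of $u$ from the sets $D_i$: if $(Ru)(t^-)=i$ and $u(t)\in(\gamma_i)$ then $(Ru)(t)=(i+1)\bmod 2$. Families. Two one-parameter families (real parameters) of open sets $D_0(c_0),D_1(c_1)\subseteq\Omega$ are given, with $\gamma_i(c_i):=\Omega\cap\partial D_i(c_i)$ continuous curves. $(c_0,c_1)$ is admissible if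 $D_0(c_0)\cup D_1(c_1)=\Omega$; then $R^{c_0c_1}$ is the relay relative to $D_0(c_0),D_1(c_1)$. The hysteresis operator with continuous weight function $w$ is $$(Hu)(t)=\iint_{(c_0,c_1)\ \text{admissible}}w(c_0,c_1)(R^{c_0c_1}u)(t)\,dc_0\,dc_1.$$ Standing conditions: (1) Every $x\in\Omega$ belongs to exactly one curve $\gamma_0(c_0)$ and to exactly one curve $\gamma_1(c_1)$; the parameters are denoted $c_0(x),c_1(x)$. (2) For each $i$ and $c_i\ne c_i'$, exactly one of $D_i(c_i)\subsetneq D_i(c_i')$, $D_i(c_i')\subsetneq D_i(c_i)$ holds. (3) $c_i<c_i'$ if $D_i(c_i)\subsetneq D_i(c_i')$. (4) For all $x,x'\in\Omega$: $c_0(x)<c_0(x')\Leftrightarrow c_1(x)>c_1(x')$. Further assumptions: (P1) $\partial\Omega\neq\emptyset$. (P2) There is a part $\Gamma$ of $\partial\Omega$ such that, if an input signal $u$ starts (at time $t_0$) outside $\Omega$ and enters $\Omega$ through $\Gamma$, then all relay outputs $(R^{c_0c_1}u)(t)$ are $0$ at the entrance time $t=t_e:=\inf\{t>t_0: u(t)\notin\mathbb{R}^2\setminus\overline\Omega\}$. (P3) There is a simple $C^1$ curve $(k)$ that intersects $\Gamma$ and intersects all curves $\gamma_0(c_0)$ and $\gamma_1(c_1)$ transversally, each of them at exactly one point. (P4) For $P,P'\in(k)$, if $c_0(P)<c_0(P')$ then the pair $(c_0(P'),c_1(P))$ is admissible. Order on $(k)$: $P<Q$ iff $c_0(P)<c_0(Q)$.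 (P5) The points of $(k)$ can be parametrized by arc length $s$ so that $P<Q\Leftrightarrow s(P)<s(Q)$. (P6) Writing $\overline P(s),\overline Q(s)$ for the point of $(k)$ with arc-length parameter $s$, the functions $s\mapsto c_0(\overline P(s))$ and $s\mapsto c_1(\overline Q(s))$ are $C^1$ and, for $s_0>s_1$, the Jacobian $$J(s_0,s_1)=\left|\frac{\partial\big(c_0(\overline P(s_0)),c_1(\overline Q(s_1))\big)}{\partial(s_0,s_1)}\right|$$ (absolute value of the Jacobian determinant) is never zero. First-order transition function: an input signal moving along $(k)$, which starts outside $\Omega$ and enters $\Omega$ through $\Gamma$, is steadily increased along $(k)$ until it reaches the point with arc-length parameter $s_0$, and is then steadily decreased along $(k)$ until it reaches the point with parameter $s_1<s_0$. With $(Hu)(s_0)$ and $(Hu)(s_1)$ denoting the outputs of $H$ at these two moments, $\psi(s_0,s_1):=(Hu)(s_0)-(Hu)(s_1)$. *)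

theory Defs
  imports "HOL-Analysis.Analysis"
begin

text \<open>
  The plane is \<^typ>\<open>real^2\<close>.  The two families of open sets are given as one map
  \<open>D :: nat \<Rightarrow> real \<Rightarrow> (real^2) set\<close> used at the indices 0 and 1, and \<open>C i\<close> is the set of real
  parameters of the family \<open>D i\<close> (take \<open>C i = UNIV\<close> if every real number is a parameter).
  All input signals start at the time \<open>t0\<close> and are functions on \<open>{t0..}\<close>.
\<close>

type_synonym signal = "real \<Rightarrow> real^2"

definition rel_boundary :: "(real^2) set \<Rightarrow> (real^2) set \<Rightarrow> (real^2) set" where
  "rel_boundary \<Omega> A = \<Omega> \<inter> frontier A"

definition continuous_curve :: "(real^2) set \<Rightarrow> bool" where
  "continuous_curve \<gamma> \<longleftrightarrow>
     (\<exists>T (g :: real \<Rightarrow> real^2). is_interval T \<and> T \<noteq> {} \<and> continuous_on T g \<and> \<gamma> = g ` T)"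

definition admissible ::
  "(real^2) set \<Rightarrow> (nat \<Rightarrow> real \<Rightarrow> (real^2) set) \<Rightarrow> (nat \<Rightarrow> real set) \<Rightarrow> real \<Rightarrow> real \<Rightarrow> bool" where
  "admissible \<Omega> D C c0 c1 \<longleftrightarrow> c0 \<in> C 0 \<and> c1 \<in> C 1 \<and> D 0 c0 \<union> D 1 c1 = \<Omega>"

text \<open>The parameter \<open>c\<^sub>i(x)\<close> of the curve \<open>\<gamma>\<^sub>i\<close> through \<open>x\<close>.\<close>

definition param ::
  "(real^2) set \<Rightarrow> (nat \<Rightarrow> real \<Rightarrow> (real^2) set) \<Rightarrow> (nat \<Rightarrow> real set) \<Rightarrow> nat \<Rightarrow> real^2 \<Rightarrow> real" where
  "param \<Omega> D C i x = (THE c. c \<in> C i \<and> x \<in> rel_boundary \<Omega> (D i c))"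


subsection \<open>Relays\<close>

definition relay_sets ::
  "(nat \<Rightarrow> real \<Rightarrow> (real^2) set) \<Rightarrow> real \<Rightarrow> real \<Rightarrow> nat \<Rightarrow> (real^2) set" where
  "relay_sets D c0 c1 i = (if i = 0 then D 0 c0 else D 1 c1)"

text \<open>
  \<open>r\<close> is an evolution, from the time \<open>ta\<close> on, of a relay with sets \<open>E 0\<close>, \<open>E 1\<close> driven by \<open>u\<close>.
  The initial value \<open>r ta\<close> is not prescribed here.  The \<open>else\<close> branch expresses that the
  value changes only at the moments of exit.
\<close>

definition relay_evolution ::
  "(real^2) set \<Rightarrow> (nat \<Rightarrow> (real^2) set) \<Rightarrow> signal \<Rightarrow> real \<Rightarrow> (real \<Rightarrow> nat) \<Rightarrow> bool" where
  "relay_evolution \<Omega> E u ta r \<longleftrightarrow>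
     (\<forall>t\<ge>ta. r t \<in> {0, 1}) \<and>
     (\<forall>t\<ge>ta. continuous (at_right t) r) \<and>
     (\<forall>t>ta. \<exists>i\<in>{0, 1}. (r \<longlongrightarrow> i) (at_left t) \<and>
        r t = (if u t \<in> rel_boundary \<Omega> (E i) then (i + 1) mod 2 else i))"

definition entrance_time :: "(real^2) set \<Rightarrow> real \<Rightarrow> signal \<Rightarrow> real" where
  "entrance_time \<Omega> t0 u = Inf {t. t > t0 \<and> u t \<notin> UNIV - closure \<Omega>}"

text \<open>
  A signal which starts outside \<open>\<Omega>\<close>, enters \<open>\<Omega>\<close> through \<open>\<Gamma>\<close> and then stays in \<open>\<Omega>\<close>, where the
  relays are defined.  The last conjunct makes the set in \<^const>\<open>entrance_time\<close> nonempty.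
\<close>

definition enters_through :: "(real^2) set \<Rightarrow> (real^2) set \<Rightarrow> real \<Rightarrow> signal \<Rightarrow> bool" where
  "enters_through \<Omega> \<Gamma> t0 u \<longleftrightarrow>
     continuous_on {t0..} u \<and> u t0 \<notin> \<Omega> \<and>
     u (entrance_time \<Omega> t0 u) \<in> \<Gamma> \<and> (\<forall>t > entrance_time \<Omega> t0 u. u t \<in> \<Omega>)"

text \<open>
  The axioms of a relay leave the initial value open when \<open>u t0\<close> lies in both sets, so a relay
  operator is any choice of an evolution for every signal.  For a signal entering through \<open>\<Gamma>\<close>
  the evolution begins at the entrance time.
\<close>

definition relay_operator ::
  "(real^2) set \<Rightarrow> (real^2) set \<Rightarrow> real \<Rightarrow> (nat \<Rightarrow> (real^2) set) \<Rightarrow> (signal \<Rightarrow> real \<Rightarrow> nat) \<Rightarrow> bool" where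
  "relay_operator \<Omega> \<Gamma> t0 E R \<longleftrightarrow>
     (\<forall>u. continuous_on {t0..} u \<and> (\<forall>t\<ge>t0. u t \<in> \<Omega>) \<longrightarrow>
        u t0 \<in> E (R u t0) \<and> relay_evolution \<Omega> E u t0 (R u)) \<and>
     (\<forall>u. enters_through \<Omega> \<Gamma> t0 u \<longrightarrow> relay_evolution \<Omega> E u (entrance_time \<Omega> t0 u) (R u))"


subsection \<open>The hysteresis operator\<close>

definition admissible_pairs ::
  "(real^2) set \<Rightarrow> (nat \<Rightarrow> real \<Rightarrow> (real^2) set) \<Rightarrow> (nat \<Rightarrow> real set) \<Rightarrow> (real \<times> real) set" where
  "admissible_pairs \<Omega> D C = {(c0, c1). admissible \<Omega> D C c0 c1}"

definition hysteresis_defined ::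
  "(real^2) set \<Rightarrow> (nat \<Rightarrow> real \<Rightarrow> (real^2) set) \<Rightarrow> (nat \<Rightarrow> real set) \<Rightarrow> (real \<Rightarrow> real \<Rightarrow> real) \<Rightarrow>
   (real \<Rightarrow> real \<Rightarrow> signal \<Rightarrow> real \<Rightarrow> nat) \<Rightarrow> signal \<Rightarrow> real \<Rightarrow> bool" where
  "hysteresis_defined \<Omega> D C w R u t \<longleftrightarrow>
     set_integrable lborel (admissible_pairs \<Omega> D C) (\<lambda>(c0, c1). w c0 c1 * real (R c0 c1 u t))"

definition hysteresis ::
  "(real^2) set \<Rightarrow> (nat \<Rightarrow> real \<Rightarrow> (real^2) set) \<Rightarrow> (nat \<Rightarrow> real set) \<Rightarrow> (real \<Rightarrow> real \<Rightarrow> real) \<Rightarrow>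
   (real \<Rightarrow> real \<Rightarrow> signal \<Rightarrow> real \<Rightarrow> nat) \<Rightarrow> signal \<Rightarrow> real \<Rightarrow> real" where
  "hysteresis \<Omega> D C w R u t =
     set_lebesgue_integral lborel (admissible_pairs \<Omega> D C)
       (\<lambda>(c0, c1). w c0 c1 * real (R c0 c1 u t))"


subsection \<open>The curve \<open>(k)\<close>\<close>

text \<open>A simple curve of class \<open>C\<^sup>1\<close> parametrized by arc length, i.e. with unit speed.\<close>

definition arc_length_curve :: "real set \<Rightarrow> (real \<Rightarrow> real^2) \<Rightarrow> bool" where
  "arc_length_curve I k \<longleftrightarrow> is_interval I \<and> inj_on k I \<and>
     (\<exists>k'. continuous_on I k' \<and>
       (\<forall>s\<in>I. (k has_vector_derivative k' s) (at s within I) \<and> norm (k' s) = 1))"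

text \<open>
  The curves \<open>\<gamma>\<^sub>i(c)\<close> are only continuous, so they have no tangents in general.
  Transversality of \<open>(k)\<close> at its point \<open>k s\<close> on the relative boundary of \<open>A\<close> means that
  \<open>(k)\<close> passes there from one side, \<open>A\<close>, to the other, \<open>\<Omega> - closure A\<close>, or conversely.
\<close>

definition crosses_at ::
  "(real^2) set \<Rightarrow> (real^2) set \<Rightarrow> real set \<Rightarrow> (real \<Rightarrow> real^2) \<Rightarrow> real \<Rightarrow> bool" where
  "crosses_at \<Omega> A I k s \<longleftrightarrow>
     (\<exists>e>0. {s - e<..<s + e} \<subseteq> I \<and>
       (k ` {s - e<..<s} \<subseteq> A \<and> k ` {s<..<s + e} \<subseteq> \<Omega> - closure A \<or>
        k ` {s - e<..<s} \<subseteq> \<Omega> - closure A \<and> k ` {s<..<s + e} \<subseteq> A))"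

text \<open>The order on the points of \<open>(k)\<close> in \<open>\<Omega>\<close>.\<close>

definition curve_less ::
  "(real^2) set \<Rightarrow> (nat \<Rightarrow> real \<Rightarrow> (real^2) set) \<Rightarrow> (nat \<Rightarrow> real set) \<Rightarrow> real set \<Rightarrow>
   (real \<Rightarrow> real^2) \<Rightarrow> real^2 \<Rightarrow> real^2 \<Rightarrow> bool" where
  "curve_less \<Omega> D C I k P Q \<longleftrightarrow>
     P \<in> k ` I \<inter> \<Omega> \<and> Q \<in> k ` I \<inter> \<Omega> \<and> param \<Omega> D C 0 P < param \<Omega> D C 0 Q"

text \<open>The point of intersection of \<open>(k)\<close> with \<open>\<gamma>\<^sub>i(c)\<close>: \<open>P(c\<^sub>0)\<close> for \<open>i = 0\<close>, \<open>Q(c\<^sub>1)\<close> for \<open>i = 1\<close>.\<close>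

definition crossing_point ::
  "(real^2) set \<Rightarrow> (nat \<Rightarrow> real \<Rightarrow> (real^2) set) \<Rightarrow> real set \<Rightarrow> (real \<Rightarrow> real^2) \<Rightarrow>
   nat \<Rightarrow> real \<Rightarrow> real^2" where
  "crossing_point \<Omega> D I k i c = (THE x. x \<in> k ` I \<and> x \<in> rel_boundary \<Omega> (D i c))"

definition W_fun ::
  "(real^2) set \<Rightarrow> (nat \<Rightarrow> real \<Rightarrow> (real^2) set) \<Rightarrow> (nat \<Rightarrow> real set) \<Rightarrow> (real \<Rightarrow> real \<Rightarrow> real) \<Rightarrow>
   real^2 \<Rightarrow> real^2 \<Rightarrow> real" where
  "W_fun \<Omega> D C w P Q = w (param \<Omega> D C 0 P) (param \<Omega> D C 1 Q)"

definition abs_jacobian ::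
  "(real \<Rightarrow> real \<Rightarrow> real) \<Rightarrow> (real \<Rightarrow> real \<Rightarrow> real) \<Rightarrow> real \<Rightarrow> real \<Rightarrow> real" where
  "abs_jacobian f g x y =
     \<bar>det (vector [vector [deriv (\<lambda>x'. f x' y) x, deriv (\<lambda>y'. f x y') y],
                   vector [deriv (\<lambda>x'. g x' y) x, deriv (\<lambda>y'. g x y') y]] :: real^2^2)\<bar>"

definition J_fun ::
  "(real^2) set \<Rightarrow> (nat \<Rightarrow> real \<Rightarrow> (real^2) set) \<Rightarrow> (nat \<Rightarrow> real set) \<Rightarrow> (real \<Rightarrow> real^2) \<Rightarrow>
   real \<Rightarrow> real \<Rightarrow> real" where
  "J_fun \<Omega> D C k =
     abs_jacobian (\<lambda>s0 s1. param \<Omega> D C 0 (k s0)) (\<lambda>s0 s1. param \<Omega> D C 1 (k s1))"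

text \<open>\<open>d\<close> is the value at \<open>(x, y)\<close> of \<open>\<partial>\<^sup>2f/\<partial>x\<partial>y = \<partial>/\<partial>x (\<partial>f/\<partial>y)\<close>, which exists there.\<close>

definition has_mixed_partial :: "(real \<Rightarrow> real \<Rightarrow> real) \<Rightarrow> real \<Rightarrow> real \<Rightarrow> real \<Rightarrow> bool" where
  "has_mixed_partial f d x y \<longleftrightarrow>
     (\<exists>fy. (\<forall>\<^sub>F x' in nhds x. ((\<lambda>y'. f x' y') has_real_derivative fy x') (at y)) \<and>
           (fy has_real_derivative d) (at x))"


subsection \<open>The first-order transition function\<close>

text \<open>
  The signal \<open>u\<close> moves along \<open>(k)\<close>, its arc-length parameter at the time \<open>t\<close> being \<open>\<sigma> t\<close>:
  it enters \<open>\<Omega>\<close> through \<open>\<Gamma>\<close>, increases up to \<open>s0\<close> (reached at \<open>t'\<close>), and then decreases down to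
  \<open>s1\<close> (reached at \<open>t''\<close>).  Its behaviour after \<open>t''\<close> is irrelevant.
\<close>

definition first_order_input ::
  "(real^2) set \<Rightarrow> (real^2) set \<Rightarrow> real \<Rightarrow> real set \<Rightarrow> (real \<Rightarrow> real^2) \<Rightarrow>
   real \<Rightarrow> real \<Rightarrow> signal \<Rightarrow> real \<Rightarrow> real \<Rightarrow> bool" where
  "first_order_input \<Omega> \<Gamma> t0 I k s0 s1 u t' t'' \<longleftrightarrow>
     enters_through \<Omega> \<Gamma> t0 u \<and> t0 < t' \<and> t' < t'' \<and>
     (\<exists>\<sigma>. continuous_on {t0..} \<sigma> \<and> (\<forall>t\<ge>t0. \<sigma> t \<in> I \<and> u t = k (\<sigma> t)) \<and>
        strict_mono_on {t0..t'} \<sigma> \<and> \<sigma> t' = s0 \<and>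
        strict_antimono_on {t'..t''} \<sigma> \<and> \<sigma> t'' = s1)"

definition transition_fun ::
  "(real^2) set \<Rightarrow> (real^2) set \<Rightarrow> (nat \<Rightarrow> real \<Rightarrow> (real^2) set) \<Rightarrow> (nat \<Rightarrow> real set) \<Rightarrow>
   (real \<Rightarrow> real \<Rightarrow> real) \<Rightarrow> (real \<Rightarrow> real \<Rightarrow> signal \<Rightarrow> real \<Rightarrow> nat) \<Rightarrow> real \<Rightarrow> real set \<Rightarrow>
   (real \<Rightarrow> real^2) \<Rightarrow> real \<Rightarrow> real \<Rightarrow> real" where
  "transition_fun \<Omega> \<Gamma> D C w R t0 I k s0 s1 =
     (THE d. \<exists>u t' t''. first_order_input \<Omega> \<Gamma> t0 I k s0 s1 u t' t'' \<and>
        d = hysteresis \<Omega> D C w R u t' - hysteresis \<Omega> D C w R u t'')"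

end

theory Submission
  imports Defs
begin

text \<open>
  Along the curve \<open>(k)\<close> the problem is the classical one of Preisach.  Put \<open>p s = c\<^sub>0(k s)\<close> and
  \<open>q s = c\<^sub>1(k s)\<close> for the arc-length parameters \<open>s\<close> inside \<open>\<Omega>\<close>: \<open>p\<close> is increasing, \<open>q\<close> is decreasing,
  every parameter of the two families is a value of \<open>p\<close>, respectively \<open>q\<close>, because every boundary
  curve meets \<open>(k)\<close>, and \<open>(p x, q y)\<close> is admissible if and only if \<open>y < x\<close>
  (\<open>admissible_iff\<close>).  Since \<open>(k)\<close> meets each boundary curve once, the relay \<open>(p x, q y)\<close> switches to 1 when
  the increasing signal reaches \<open>x\<close> and back to 0 when the decreasing signal reaches \<open>y\<close>
  (\<open>relay_up_down\<close>, \<open>relay_outputs\<close>).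

  Hence the output of the hysteresis operator drops, between the turning point \<open>s\<^sub>0\<close> and the end
  point \<open>s\<^sub>1\<close>, by the integral of \<open>w\<close> over the triangle \<open>s\<^sub>1 \<le> y < x \<le> s\<^sub>0\<close> (\<open>output_drop\<close>).  By Fubini,
  \<open>\<psi>(s\<^sub>0, s\<^sub>1)\<close> is the integral over \<open>v\<close> from \<open>q(s\<^sub>0)\<close> to \<open>q(s\<^sub>1)\<close> of the integral of \<open>w(u, v)\<close> over \<open>u\<close>
  from \<open>p(q\<^sup>-\<^sup>1(v))\<close> to \<open>p(s\<^sub>0)\<close>,
  where \<open>s\<^sub>1\<close> occurs only in the outer upper limit.  Two applications of the fundamental theorem of
  calculus give \<open>q'(s\<^sub>1)\<close> times the integral of \<open>w(u, q(s\<^sub>1))\<close> over \<open>u\<close> from \<open>p(s\<^sub>1)\<close> to \<open>p(s\<^sub>0)\<close>, and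
  then \<open>p'(s\<^sub>0) q'(s\<^sub>1) w(p(s\<^sub>0), q(s\<^sub>1))\<close>.  As \<open>p' \<ge> 0 \<ge> q'\<close>, the factor \<open>p'(s\<^sub>0) q'(s\<^sub>1)\<close> is the negative of
  the absolute Jacobian.
\<close>

section \<open>Switching of a single relay\<close>

lemma relay_step:
  assumes ev: "relay_evolution \<Omega> E u ta r"
    and "ta \<le> \<alpha>" "\<alpha> < \<beta>" and before: "\<And>\<tau>. \<alpha> \<le> \<tau> \<Longrightarrow> \<tau> < \<beta> \<Longrightarrow> r \<tau> = i"
  shows "r \<beta> = (if u \<beta> \<in> rel_boundary \<Omega> (E i) then (i + 1) mod 2 else i)"
proof -
  have "ta < \<beta>" using assms(2,3) by simp
  then obtain j where j: "(r \<longlongrightarrow> j) (at_left \<beta>)"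
    "r \<beta> = (if u \<beta> \<in> rel_boundary \<Omega> (E j) then (j + 1) mod 2 else j)"
    using ev unfolding relay_evolution_def by blast
  have "\<forall>\<^sub>F \<tau> in at_left \<beta>. r \<tau> = i"
    unfolding eventually_at_left_field using \<open>\<alpha> < \<beta>\<close> before by (intro exI[of _ \<alpha>]) auto
  then have "(r \<longlongrightarrow> i) (at_left \<beta>)" by (rule tendsto_eventually)
  then have "j = i" using j(1) by (intro tendsto_unique[of "at_left \<beta>" r]) auto
  then show ?thesis using j(2) by simp
qed

lemma relay_stays:
  assumes ev: "relay_evolution \<Omega> E u ta r"
    and "ta \<le> \<alpha>" "\<alpha> \<le> t" and start: "r \<alpha> = i"
    and away: "\<And>\<tau>. \<alpha> < \<tau> \<Longrightarrow> \<tau> \<le> t \<Longrightarrow> u \<tau> \<notin> rel_boundary \<Omega> (E i)"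
  shows "r t = i"
proof (rule ccontr)
  assume neq: "r t \<noteq> i"
  \<comment> \<open>The infimum \<open>m\<close> of the times at which the value differs is attained, because the relay is
    right-continuous with values in a discrete space; hence it is a switching time.\<close>
  define B where "B = {\<tau> \<in> {\<alpha>..t}. r \<tau> \<noteq> i}"
  define m where "m = Inf B"
  have B: "B \<noteq> {}" "bdd_below B" "t \<in> B"
    using neq \<open>\<alpha> \<le> t\<close> by (auto simp: B_def intro!: bdd_belowI[of _ \<alpha>])
  have m: "\<alpha> \<le> m" "m \<le> t"
    unfolding m_def using B by (auto intro!: cInf_greatest cInf_lower simp: B_def)
  have before: "r \<tau> = i" if "\<alpha> \<le> \<tau>" "\<tau> < m" for \<tau>
  proof (rule ccontr)
    assume "r \<tau> \<noteq> i"
    then have "\<tau> \<in> B" using that m by (auto simp: B_def)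
    then have "m \<le> \<tau>" unfolding m_def by (rule cInf_lower[OF _ B(2)])
    then show False using that by simp
  qed
  have "r m \<noteq> i"
  proof
    assume "r m = i"
    have "continuous (at_right m) r"
      using ev m \<open>ta \<le> \<alpha>\<close> by (auto simp: relay_evolution_def)
    then have "\<forall>\<^sub>F \<tau> in at_right m. r \<tau> = i"
      using \<open>r m = i\<close> by (simp add: continuous_within tendsto_discrete)
    then obtain b where b: "b > m" "\<And>\<tau>. m < \<tau> \<Longrightarrow> \<tau> < b \<Longrightarrow> r \<tau> = i"
      by (auto simp: eventually_at_right_field)
    have "b \<le> \<tau>" if "\<tau> \<in> B" for \<tau>
    proof -
      have "m \<le> \<tau>" unfolding m_def by (rule cInf_lower[OF that B(2)])
      moreover have "\<tau> \<noteq> m" using that \<open>r m = i\<close> by (auto simp: B_def)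
      ultimately show ?thesis using b(2)[of \<tau>] that by (force simp: B_def)
    qed
    then have "b \<le> m" unfolding m_def by (intro cInf_greatest B)
    then show False using b by simp
  qed
  then have "\<alpha> < m" using start m by (cases "m = \<alpha>") auto
  have "r m = (if u m \<in> rel_boundary \<Omega> (E i) then (i + 1) mod 2 else i)"
    by (rule relay_step[OF ev \<open>ta \<le> \<alpha>\<close> \<open>\<alpha> < m\<close> before])
  then show False using \<open>r m \<noteq> i\<close> away[OF \<open>\<alpha> < m\<close> m(2)] by simp
qed

lemma relay_switches:
  assumes ev: "relay_evolution \<Omega> E u ta r"
    and "ta \<le> \<alpha>" "\<alpha> < \<beta>" and start: "r \<alpha> = i"
    and away: "\<And>\<tau>. \<alpha> < \<tau> \<Longrightarrow> \<tau> < \<beta> \<Longrightarrow> u \<tau> \<notin> rel_boundary \<Omega> (E i)"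
    and contact: "u \<beta> \<in> rel_boundary \<Omega> (E i)"
  shows "r \<beta> = (i + 1) mod 2"
proof -
  have before: "r \<tau> = i" if "\<alpha> \<le> \<tau>" "\<tau> < \<beta>" for \<tau>
    using relay_stays[OF ev \<open>ta \<le> \<alpha>\<close> that(1) start] away that by force
  show ?thesis using relay_step[OF ev \<open>ta \<le> \<alpha>\<close> \<open>\<alpha> < \<beta>\<close> before] contact by simp
qed

text \<open>
  One sweep of a relay whose contact with the two boundaries is read off a scalar \<open>\<sigma>\<close>: the boundary
  of \<open>E 0\<close> is met exactly at the value \<open>x\<close> and that of \<open>E 1\<close> exactly at \<open>y < x\<close>.  As in the classical
  Preisach relay with thresholds \<open>y < x\<close>, equality \<open>\<sigma> t' = x\<close> already switches on and \<open>\<sigma> t'' = y\<close>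
  already switches off.
\<close>

lemma relay_up_down:
  fixes \<sigma> :: "real \<Rightarrow> real"
  assumes ev: "relay_evolution \<Omega> E u te r" and start: "r te = 0"
    and times: "te < t'" "t' < t''"
    and cont: "continuous_on {te..t''} \<sigma>"
    and up: "strict_mono_on {te..t'} \<sigma>" and down: "strict_antimono_on {t'..t''} \<sigma>"
    and contact: "\<And>t. te \<le> t \<Longrightarrow> t \<le> t'' \<Longrightarrow> u t \<in> rel_boundary \<Omega> (E 0) \<longleftrightarrow> \<sigma> t = x"
                 "\<And>t. te \<le> t \<Longrightarrow> t \<le> t'' \<Longrightarrow> u t \<in> rel_boundary \<Omega> (E 1) \<longleftrightarrow> \<sigma> t = y"
    and "y < x" "\<sigma> te < y"
  shows "r t' = of_bool (x \<le> \<sigma> t')" "r t'' = of_bool (x \<le> \<sigma> t' \<and> y < \<sigma> t'')"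
proof -
  have inc: "\<sigma> s < \<sigma> t" if "te \<le> s" "s < t" "t \<le> t'" for s t
    using strict_mono_onD[OF up, of s t] that by auto
  have dec: "\<sigma> t < \<sigma> s" if "t' \<le> s" "s < t" "t \<le> t''" for s t
    using down that by (auto simp: monotone_on_def)
  have below: "\<sigma> t \<le> \<sigma> t'" if "te \<le> t" "t \<le> t''" for t
    using inc[of t t'] dec[of t' t] that by (cases t t' rule: linorder_cases) auto
  have "r t' = of_bool (x \<le> \<sigma> t') \<and> r t'' = of_bool (x \<le> \<sigma> t' \<and> y < \<sigma> t'')"
  proof (cases "x \<le> \<sigma> t'")
    case False
    have "r t = 0" if "te \<le> t" "t \<le> t''" for t
      by (rule relay_stays[OF ev _ _ start]) (use that contact(1) below False in force)+
    then show ?thesis using False times by simp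
  next
    case True
    obtain \<tau> where \<tau>: "te \<le> \<tau>" "\<tau> \<le> t'" "\<sigma> \<tau> = x"
      using IVT'[of \<sigma> te x t'] True \<open>y < x\<close> \<open>\<sigma> te < y\<close> times continuous_on_subset[OF cont]
      by (smt (verit) atLeastatMost_subset_iff)
    then have "te < \<tau>" using \<open>y < x\<close> \<open>\<sigma> te < y\<close> by (cases "te = \<tau>") auto
    have on: "r \<tau> = 1"
      using relay_switches[OF ev order_refl \<open>te < \<tau>\<close> start] contact(1) \<tau> inc times
      by (smt (verit) add_0 one_mod_two_eq_one)
    have above: "x < \<sigma> t" if "\<tau> < t" "t \<le> t'" for t
      using inc[of \<tau> t] \<tau> that by auto
    have r': "r t' = 1"
      by (rule relay_stays[OF ev _ _ on])
        (use \<tau> contact(2) above \<open>y < x\<close> times in \<open>force+\<close>)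
    show ?thesis
    proof (cases "y < \<sigma> t''")
      case True
      have "y < \<sigma> t" if "t' < t" "t \<le> t''" for t
        using dec[of t t''] True that by (cases "t = t''") auto
      then have "r t'' = 1"
        by (intro relay_stays[OF ev _ _ r'] notI) (use contact(2) times in \<open>force+\<close>)
      then show ?thesis using True \<open>x \<le> \<sigma> t'\<close> r' by simp
    next
      case False
      obtain \<rho> where \<rho>: "t' \<le> \<rho>" "\<rho> \<le> t''" "\<sigma> \<rho> = y"
        using IVT2'[of \<sigma> t'' y t'] False \<open>x \<le> \<sigma> t'\<close> \<open>y < x\<close> times continuous_on_subset[OF cont]
        by (smt (verit) atLeastatMost_subset_iff)
      then have "t' < \<rho>" using \<open>y < x\<close> \<open>x \<le> \<sigma> t'\<close> by (cases "t' = \<rho>") auto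
      have above': "y < \<sigma> t" if "t' < t" "t < \<rho>" for t
        using dec[of t \<rho>] \<rho> that by auto
      have "r \<rho> = (1 + 1) mod 2"
        by (rule relay_switches[OF ev _ \<open>t' < \<rho>\<close> r'])
          (use contact(2) above' \<rho> times in \<open>force+\<close>)
      then have off: "r \<rho> = 0" by simp
      have "\<sigma> t < y" if "\<rho> < t" "t \<le> t''" for t
        using dec[of \<rho> t] \<rho> that by auto
      then have "r t'' = 0"
        by (intro relay_stays[OF ev _ _ off] notI)
          (use contact(1) \<rho> times \<open>y < x\<close> in \<open>force+\<close>)
      then show ?thesis using False \<open>x \<le> \<sigma> t'\<close> r' by simp
    qed
  qed
  then show "r t' = of_bool (x \<le> \<sigma> t')" "r t'' = of_bool (x \<le> \<sigma> t' \<and> y < \<sigma> t'')" by auto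
qed

section \<open>Integrals over regions with a curved side\<close>

lemma continuous_on_integral_lower_limit:
  fixes f :: "real \<Rightarrow> real \<Rightarrow> real" and P :: "real \<Rightarrow> real"
  assumes f: "continuous_on ({A..B} \<times> V) (\<lambda>(u, v). f u v)"
    and P: "continuous_on V P" "\<And>v. v \<in> V \<Longrightarrow> A \<le> P v \<and> P v \<le> B"
  shows "continuous_on V (\<lambda>v. integral {P v..B} (\<lambda>u. f u v))"
proof -
  \<comment> \<open>Extending the integrand to the left of \<open>P v\<close> by its value at \<open>P v\<close> makes the interval of
    integration independent of \<open>v\<close>.\<close>
  have clamp: "continuous_on (V \<times> {A..B}) (\<lambda>(v, u). f (max u (P v)) v)"
  proof -
    have max: "continuous_on (V \<times> {A..B}) (\<lambda>z. max (snd z) (P (fst z)))"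
      by (intro continuous_intros continuous_on_compose2[OF P(1)]) auto
    have "continuous_on (V \<times> {A..B}) (\<lambda>z. (\<lambda>(u, v). f u v) (max (snd z) (P (fst z)), fst z))"
      by (rule continuous_on_compose2[OF f])
        (use P(2) in \<open>auto intro!: continuous_on_Pair max continuous_on_fst continuous_on_id
            simp: le_max_iff_disj\<close>)
    then show ?thesis by (simp add: case_prod_beta)
  qed
  have corner: "continuous_on V (\<lambda>v. f (P v) v)"
  proof -
    have "continuous_on V (\<lambda>v. (\<lambda>(u, v). f u v) (P v, v))"
      by (rule continuous_on_compose2[OF f]) (use P in \<open>auto intro!: continuous_intros\<close>)
    then show ?thesis by simp
  qed
  have split: "integral {P v..B} (\<lambda>u. f u v)
      = integral {A..B} (\<lambda>u. f (max u (P v)) v) - (P v - A) * f (P v) v" if "v \<in> V" for v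
  proof -
    have "continuous_on {A..B} (\<lambda>u. (\<lambda>(v, u). f (max u (P v)) v) (v, u))"
      by (rule continuous_on_compose2[OF clamp]) (use that in \<open>auto intro!: continuous_intros\<close>)
    then have int: "(\<lambda>u. f (max u (P v)) v) integrable_on {A..B}"
      by (intro integrable_continuous_interval) simp
    have "integral {A..P v} (\<lambda>u. f (max u (P v)) v) + integral {P v..B} (\<lambda>u. f (max u (P v)) v)
        = integral {A..B} (\<lambda>u. f (max u (P v)) v)"
      using P(2)[OF that] int by (intro Henstock_Kurzweil_Integration.integral_combine) auto
    moreover have "integral {A..P v} (\<lambda>u. f (max u (P v)) v) = integral {A..P v} (\<lambda>u. f (P v) v)"
      by (intro Henstock_Kurzweil_Integration.integral_cong) (auto simp: max_def)
    moreover have "integral {P v..B} (\<lambda>u. f (max u (P v)) v) = integral {P v..B} (\<lambda>u. f u v)"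
      by (intro Henstock_Kurzweil_Integration.integral_cong) (auto simp: max_def)
    ultimately show ?thesis using P(2)[OF that] by simp
  qed
  have "continuous_on V (\<lambda>v. integral {A..B} (\<lambda>u. f (max u (P v)) v))"
    using integral_continuous_on_param[of V A B "\<lambda>v u. f (max u (P v)) v"] clamp by simp
  then have "continuous_on V
      (\<lambda>v. integral {A..B} (\<lambda>u. f (max u (P v)) v) - (P v - A) * f (P v) v)"
    by (intro continuous_intros P corner)
  then show ?thesis using split by (simp cong: continuous_on_cong)
qed

text \<open>
  Fubini over a region bounded by a curve.  The inner integral runs over the first coordinate; the
  excluded points of the curve \<open>u = P v\<close> do not contribute.
\<close>

lemma integral_below_upper_bound:
  fixes f :: "real \<Rightarrow> real \<Rightarrow> real" and P :: "real \<Rightarrow> real" and A B c d :: real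
  defines "T \<equiv> {(u, v). c \<le> v \<and> v \<le> d \<and> P v < u \<and> u \<le> B}"
  assumes f: "continuous_on ({A..B} \<times> {c..d}) (\<lambda>(u, v). f u v)"
    and P: "continuous_on {c..d} P" "\<And>v. v \<in> {c..d} \<Longrightarrow> A \<le> P v \<and> P v \<le> B"
    and int: "set_integrable lborel T (\<lambda>(u, v). f u v)"
  shows "(LINT z:T|lborel. (case z of (u, v) \<Rightarrow> f u v))
      = integral {c..d} (\<lambda>v. integral {P v..B} (\<lambda>u. f u v))"
proof -
  define g where "g v = integral {P v..B} (\<lambda>u. f u v)" for v
  have inner: "(LINT u|lborel. indicator T (u, v) * f u v) = indicator {c..d} v * g v" for v
  proof (cases "v \<in> {c..d}")
    case True
    have "continuous_on {P v..B} (\<lambda>u. (\<lambda>(u, v). f u v) (u, v))"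
      by (rule continuous_on_compose2[OF f])
        (use True P(2)[of v] in \<open>auto intro!: continuous_intros\<close>)
    then have "set_integrable lborel {P v..B} (\<lambda>u. f u v)"
      by (intro borel_integrable_atLeastAtMost') simp
    then have "set_integrable lborel {P v<..B} (\<lambda>u. f u v)"
      by (rule set_integrable_subset) auto
    then have "(LINT u:{P v<..B}|lborel. f u v) = integral {P v<..B} (\<lambda>u. f u v)"
      by (rule set_borel_integral_eq_integral)
    also have "\<dots> = g v"
    proof -
      have "{P v..B} - {P v<..B} \<subseteq> {P v}" by auto
      then have "negligible ({P v..B} - {P v<..B})"
        by (rule negligible_subset[OF negligible_sing])
      then show ?thesis unfolding g_def by (intro integral_subset_negligible) auto
    qed
    finally have "(LINT u:{P v<..B}|lborel. f u v) = g v" .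
    moreover have "indicator T (u, v) = (indicator {P v<..B} u :: real)" for u
      using True by (auto simp: T_def indicator_def)
    ultimately show ?thesis using True by (simp add: set_lebesgue_integral_def)
  qed (auto simp: T_def)
  have "integrable (lborel \<Otimes>\<^sub>M lborel) (case_prod (\<lambda>u v. indicator T (u, v) * f u v))"
    using int by (simp add: set_integrable_def lborel_prod case_prod_unfold)
  then have "(LINT v|lborel. LINT u|lborel. indicator T (u, v) * f u v)
      = integral\<^sup>L (lborel \<Otimes>\<^sub>M lborel) (case_prod (\<lambda>u v. indicator T (u, v) * f u v))"
    by (rule lborel_pair.integral_snd)
  then have "(LINT z:T|lborel. (case z of (u, v) \<Rightarrow> f u v)) = (LINT v:{c..d}|lborel. g v)"
    by (simp add: inner set_lebesgue_integral_def lborel_prod case_prod_unfold)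
  also have "\<dots> = integral {c..d} g"
    using continuous_on_integral_lower_limit[OF f P]
    by (intro set_borel_integral_eq_integral(2) borel_integrable_atLeastAtMost') (simp add: g_def)
  finally show ?thesis by (simp add: g_def[abs_def])
qed

lemma integral_upper_limit_has_derivative:
  fixes g h :: "real \<Rightarrow> real"
  assumes "continuous_on {c..d} g" "c < h x" "h x < d" "(h has_real_derivative h') (at x)"
  shows "((\<lambda>x. integral {c..h x} g) has_real_derivative h' * g (h x)) (at x)"
proof -
  have "((\<lambda>z. integral {c..z} g) has_real_derivative g (h x)) (at (h x) within {c..d})"
    using assms by (intro integral_has_real_derivative) auto
  then have "((\<lambda>z. integral {c..z} g) has_real_derivative g (h x)) (at (h x))"
    by (simp only: at_within_Icc_at[OF assms(2,3)])
  from DERIV_chain2[OF this assms(4)] show ?thesis by (simp add: mult.commute)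
qed

section \<open>The two families along the curve\<close>

text \<open>
  Two monotone families of open sets with a curve crossing each boundary once.  \<open>S\<close> consists of the
  arc-length parameters of the points of the curve inside \<open>\<Omega>\<close>, which are those beyond \<open>a\<close>.
\<close>

locale transversal_families =
  fixes \<Omega> :: "(real^2) set" and D :: "nat \<Rightarrow> real \<Rightarrow> (real^2) set" and C :: "nat \<Rightarrow> real set"
    and I S :: "real set" and k :: "real \<Rightarrow> real^2" and a :: real
  assumes D_open: "\<And>i c. i < 2 \<Longrightarrow> c \<in> C i \<Longrightarrow> open (D i c) \<and> D i c \<subseteq> \<Omega>"
    and unique_curve:
      "\<And>i x. i < 2 \<Longrightarrow> x \<in> \<Omega> \<Longrightarrow> \<exists>!c. c \<in> C i \<and> x \<in> rel_boundary \<Omega> (D i c)"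
    and nested: "\<And>i c c'. i < 2 \<Longrightarrow> c \<in> C i \<Longrightarrow> c' \<in> C i \<Longrightarrow> c \<noteq> c' \<Longrightarrow>
          (D i c \<subset> D i c') \<noteq> (D i c' \<subset> D i c)"
    and nested_less: "\<And>i c c'. i < 2 \<Longrightarrow> c \<in> C i \<Longrightarrow> c' \<in> C i \<Longrightarrow> D i c \<subset> D i c' \<Longrightarrow> c < c'"
    and opposite: "\<And>x x'. x \<in> \<Omega> \<Longrightarrow> x' \<in> \<Omega> \<Longrightarrow>
          param \<Omega> D C 0 x < param \<Omega> D C 0 x' \<longleftrightarrow> param \<Omega> D C 1 x > param \<Omega> D C 1 x'"
    and curve: "arc_length_curve I k"
    and start: "a \<in> I"
    and S_eq: "S = {s \<in> I. k s \<in> \<Omega>}" "S = {s \<in> I. a < s}"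
    and one_crossing: "\<And>i c. i < 2 \<Longrightarrow> c \<in> C i \<Longrightarrow>
          \<exists>!x. x \<in> k ` I \<and> x \<in> rel_boundary \<Omega> (D i c)"
    and transversal: "\<And>i c s. i < 2 \<Longrightarrow> c \<in> C i \<Longrightarrow> s \<in> I \<Longrightarrow>
          k s \<in> rel_boundary \<Omega> (D i c) \<Longrightarrow> crosses_at \<Omega> (D i c) I k s"
    and admissibleI: "\<And>P P'. P \<in> k ` I \<inter> \<Omega> \<Longrightarrow> P' \<in> k ` I \<inter> \<Omega> \<Longrightarrow>
          param \<Omega> D C 0 P < param \<Omega> D C 0 P' \<Longrightarrow>
          admissible \<Omega> D C (param \<Omega> D C 0 P') (param \<Omega> D C 1 P)"
    and curve_less: "\<And>s s'. s \<in> S \<Longrightarrow> s' \<in> S \<Longrightarrow> curve_less \<Omega> D C I k (k s) (k s') \<longleftrightarrow> s < s'"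
    and C1: "(\<lambda>s. param \<Omega> D C 0 (k s)) C1_differentiable_on S"
            "(\<lambda>s. param \<Omega> D C 1 (k s)) C1_differentiable_on S"
begin

text \<open>The parameters of the two boundary curves through the point \<open>k s\<close>; meaningful for \<open>s \<in> S\<close> only.\<close>

definition p :: "real \<Rightarrow> real" where "p s = param \<Omega> D C 0 (k s)"

definition q :: "real \<Rightarrow> real" where "q s = param \<Omega> D C 1 (k s)"

lemma S_D: "s \<in> S \<Longrightarrow> s \<in> I \<and> a < s \<and> k s \<in> \<Omega>"
  using S_eq by auto

lemma k_inj: "s \<in> I \<Longrightarrow> s' \<in> I \<Longrightarrow> k s = k s' \<longleftrightarrow> s = s'"
  using curve by (auto simp: arc_length_curve_def inj_on_def)

lemma k_continuous: "continuous_on I k"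
  using curve unfolding arc_length_curve_def
  by (meson continuous_on_eq_continuous_within has_vector_derivative_continuous)

lemma I_between: "s \<in> I \<Longrightarrow> s' \<in> I \<Longrightarrow> s \<le> t \<Longrightarrow> t \<le> s' \<Longrightarrow> t \<in> I"
  using curve unfolding arc_length_curve_def is_interval_1 by blast

lemma S_below: "s \<in> S \<Longrightarrow> a < t \<Longrightarrow> t \<le> s \<Longrightarrow> t \<in> S"
  using I_between[OF start] S_eq by auto

lemma param:
  assumes "i < 2" "x \<in> \<Omega>"
  shows "param \<Omega> D C i x \<in> C i" "x \<in> rel_boundary \<Omega> (D i (param \<Omega> D C i x))"
  using theI'[OF unique_curve[OF assms]] by (auto simp: param_def)

lemma param_eq:
  assumes "i < 2" "c \<in> C i" "x \<in> rel_boundary \<Omega> (D i c)"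
  shows "param \<Omega> D C i x = c"
  using assms unique_curve[OF assms(1), of x] unfolding param_def
  by (intro the1_equality) (auto simp: rel_boundary_def)

text \<open>
  Along \<open>(k)\<close>, the boundary curve through \<open>k x\<close> is met only at the arc-length parameter \<open>x\<close>, so the
  motion of a signal along \<open>(k)\<close> determines its contacts.
\<close>

lemma contact_iff:
  assumes "i < 2" "x \<in> S" "s \<in> I"
  shows "k s \<in> rel_boundary \<Omega> (D i (param \<Omega> D C i (k x))) \<longleftrightarrow> s = x"
proof -
  have x: "k x \<in> \<Omega>" "x \<in> I" using S_D[OF assms(2)] by auto
  note p = param[OF assms(1) x(1)]
  show ?thesis
    using one_crossing[OF assms(1) p(1)] p(2) k_inj[OF assms(3) x(2)] assms(3) x(2) by auto
qed

lemma parameter_on_curve: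
  assumes "i < 2" "c \<in> C i"
  obtains s where "s \<in> S" "param \<Omega> D C i (k s) = c" "crossing_point \<Omega> D I k i c = k s"
proof -
  from one_crossing[OF assms] obtain s where s: "s \<in> I" "k s \<in> rel_boundary \<Omega> (D i c)" by blast
  have "crossing_point \<Omega> D I k i c = k s"
    unfolding crossing_point_def by (rule the1_equality[OF one_crossing[OF assms]]) (use s in auto)
  moreover have "s \<in> S" using s S_eq by (auto simp: rel_boundary_def)
  ultimately show thesis using that param_eq[OF assms s(2)] by blast
qed

lemma p_less: "x \<in> S \<Longrightarrow> y \<in> S \<Longrightarrow> p x < p y \<longleftrightarrow> x < y"
  using curve_less[of x y] S_D[of x] S_D[of y] by (auto simp: curve_less_def p_def)

lemma q_less: "x \<in> S \<Longrightarrow> y \<in> S \<Longrightarrow> q x < q y \<longleftrightarrow> y < x"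
  using p_less[of y x] opposite[of "k y" "k x"] S_D[of x] S_D[of y] by (auto simp: q_def p_def)

lemma p_le: "x \<in> S \<Longrightarrow> y \<in> S \<Longrightarrow> p x \<le> p y \<longleftrightarrow> x \<le> y"
  by (metis linorder_not_less p_less)

lemma q_le: "x \<in> S \<Longrightarrow> y \<in> S \<Longrightarrow> q x \<le> q y \<longleftrightarrow> y \<le> x"
  by (metis linorder_not_less q_less)

lemma p_mem: "x \<in> S \<Longrightarrow> p x \<in> C 0" and q_mem: "x \<in> S \<Longrightarrow> q x \<in> C 1"
  using param(1)[of 0 "k x"] param(1)[of 1 "k x"] S_D[of x] by (auto simp: p_def q_def)

lemma D_strict_mono:
  assumes "i < 2" "c \<in> C i" "c' \<in> C i" "c < c'" shows "D i c \<subset> D i c'"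
  using nested[OF assms(1-3)] nested_less[OF assms(1,3,2)] assms(4) by auto

lemma not_in_own_set:
  assumes "i < 2" "x \<in> S" shows "k x \<notin> D i (param \<Omega> D C i (k x))"
  using param[OF assms(1), of "k x"] S_D[OF assms(2)] D_open[OF assms(1)]
  by (auto simp: rel_boundary_def frontier_def interior_open)

text \<open>\<open>q\<close> is decreasing, so \<open>D 1 (q y)\<close> is contained in \<open>D 1 (q x)\<close>, whose boundary contains \<open>k x\<close>.\<close>

lemma not_in_D1:
  assumes "x \<in> S" "y \<in> S" "x \<le> y" shows "k x \<notin> D 1 (q y)"
  using not_in_own_set[of 1 x] D_strict_mono[of 1 "q y" "q x"] q_le[of y x] q_mem assms
  by (cases "q y = q x") (auto simp: q_def)

text \<open>
  In the coordinates \<open>(x, y) \<mapsto> (p x, q y)\<close> the admissible pairs are those with \<open>y < x\<close>.  If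
  \<open>x \<le> y\<close>, then \<open>k x\<close> lies in neither of the two sets, which therefore do not cover \<open>\<Omega>\<close>.
\<close>

lemma admissible_iff:
  assumes "x \<in> S" "y \<in> S"
  shows "admissible \<Omega> D C (p x) (q y) \<longleftrightarrow> y < x"
proof
  assume "admissible \<Omega> D C (p x) (q y)"
  then have "k x \<in> D 0 (p x) \<union> D 1 (q y)" using S_D[OF assms(1)] by (auto simp: admissible_def)
  then show "y < x"
    using not_in_own_set[of 0 x] not_in_D1[of x y] assms by (force simp: p_def)
next
  assume "y < x"
  then have "param \<Omega> D C 0 (k y) < param \<Omega> D C 0 (k x)" using p_less assms by (simp add: p_def)
  then show "admissible \<Omega> D C (p x) (q y)"
    using admissibleI[of "k y" "k x"] S_D assms by (auto simp: p_def q_def)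
qed

lemma admissibleE:
  assumes "admissible \<Omega> D C c0 c1"
  obtains x y where "x \<in> S" "y \<in> S" "y < x" "c0 = p x" "c1 = q y"
    "crossing_point \<Omega> D I k 0 c0 = k x" "crossing_point \<Omega> D I k 1 c1 = k y"
proof -
  have "c0 \<in> C 0" "c1 \<in> C 1" using assms by (auto simp: admissible_def)
  obtain x where x: "x \<in> S" "p x = c0" "crossing_point \<Omega> D I k 0 c0 = k x"
    using parameter_on_curve[OF _ \<open>c0 \<in> C 0\<close>] unfolding p_def by auto
  obtain y where y: "y \<in> S" "q y = c1" "crossing_point \<Omega> D I k 1 c1 = k y"
    using parameter_on_curve[OF _ \<open>c1 \<in> C 1\<close>] unfolding q_def by auto
  show thesis using that[OF x(1) y(1)] admissible_iff[OF x(1) y(1)] assms x y by simp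
qed

text \<open>
  A transversal crossing takes place at an interior parameter of \<open>I\<close>, and every point of \<open>(k)\<close> in
  \<open>\<Omega>\<close> is a crossing.
\<close>

lemma open_S: "open S"
proof (rule openI)
  fix s assume s: "s \<in> S"
  note s' = S_D[OF s]
  from param[of 0 "k s"] s' have "crosses_at \<Omega> (D 0 (p s)) I k s"
    by (intro transversal) (auto simp: p_def)
  then obtain e where e: "e > 0" "{s - e<..<s + e} \<subseteq> I" by (auto simp: crosses_at_def)
  have "ball s (min e (s - a)) \<subseteq> S"
  proof
    fix t assume "t \<in> ball s (min e (s - a))"
    then have "\<bar>s - t\<bar> < e" "\<bar>s - t\<bar> < s - a" by (auto simp: dist_real_def)
    then have "t \<in> {s - e<..<s + e}" "a < t" by auto
    then show "t \<in> S" using e(2) unfolding S_eq(2) by blast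
  qed
  then show "\<exists>e>0. ball s e \<subseteq> S" using e s' by (intro exI[of _ "min e (s - a)"]) auto
qed

lemma p_deriv: "s \<in> S \<Longrightarrow> (p has_real_derivative deriv p s) (at s)"
  and q_deriv: "s \<in> S \<Longrightarrow> (q has_real_derivative deriv q s) (at s)"
proof -
  have *: "(f has_real_derivative deriv f s) (at s)"
    if f: "f C1_differentiable_on S" and "s \<in> S" for f :: "real \<Rightarrow> real"
  proof -
    from f obtain f' where "(f has_vector_derivative f' s) (at s)"
      using \<open>s \<in> S\<close> unfolding C1_differentiable_on_def by blast
    then have "(f has_real_derivative f' s) (at s)"
      by (simp add: has_real_derivative_iff_has_vector_derivative)
    then show ?thesis using DERIV_imp_deriv by metis
  qed
  show "s \<in> S \<Longrightarrow> (p has_real_derivative deriv p s) (at s)"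
    "s \<in> S \<Longrightarrow> (q has_real_derivative deriv q s) (at s)"
    using C1[folded p_def q_def] by (auto intro: *)
qed

lemma p_continuous: "continuous_on S p"
  by (rule DERIV_continuous_on[OF has_field_derivative_at_within[OF p_deriv]])

lemma q_continuous: "continuous_on S q"
  by (rule DERIV_continuous_on[OF has_field_derivative_at_within[OF q_deriv]])

lemma deriv_signs:
  assumes s: "s \<in> S"
  shows "deriv p s \<ge> 0" "deriv q s \<le> 0"
proof -
  have int: "s \<in> interior S" using s open_S by (simp add: interior_open)
  have "mono_on S p" by (auto intro!: mono_onI simp: p_le)
  from mono_on_imp_deriv_nonneg[OF this p_deriv[OF s] int] show "deriv p s \<ge> 0" .
  have "mono_on S (\<lambda>s. - q s)" by (auto intro!: mono_onI simp: q_le)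
  from mono_on_imp_deriv_nonneg[OF this DERIV_minus[OF q_deriv[OF s]] int]
  show "deriv q s \<le> 0" by simp
qed

text \<open>The Jacobian matrix is diagonal, and its entries have opposite signs.\<close>

lemma J_eq:
  assumes "s0 \<in> S" "s1 \<in> S"
  shows "J_fun \<Omega> D C k s0 s1 = - (deriv p s0 * deriv q s1)"
proof -
  have "J_fun \<Omega> D C k s0 s1 = \<bar>deriv p s0 * deriv q s1\<bar>"
    by (simp add: J_fun_def abs_jacobian_def det_2 p_def[abs_def] q_def[abs_def])
  also have "\<dots> = - (deriv p s0 * deriv q s1)"
    using deriv_signs assms by (simp add: mult_nonneg_nonpos)
  finally show ?thesis .
qed

text \<open>The arc-length parameter at which \<open>(k)\<close> meets a curve of the second family; used on \<open>q ` S\<close> only.\<close>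

definition qinv :: "real \<Rightarrow> real" where "qinv = the_inv_into S q"

lemma qinv_q: "s \<in> S \<Longrightarrow> qinv (q s) = s"
proof -
  have "inj_on q S" by (rule inj_onI) (auto simp: order_eq_iff q_le)
  then show "s \<in> S \<Longrightarrow> qinv (q s) = s" unfolding qinv_def by (rule the_inv_into_f_f)
qed

lemma q_image:
  assumes "x \<in> S" "y \<in> S" "x \<le> y" shows "q ` {x..y} = {q y..q x}"
proof -
  have sub: "{x..y} \<subseteq> S" using S_below[OF assms(2)] S_D[OF assms(1)] by auto
  show ?thesis
  proof (intro equalityI subsetI)
    fix v assume "v \<in> {q y..q x}"
    then obtain s where "x \<le> s" "s \<le> y" "q s = v"
      using IVT2'[of q y v x] assms(3) continuous_on_subset[OF q_continuous sub] by auto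
    then show "v \<in> q ` {x..y}" by auto
  next
    fix v assume "v \<in> q ` {x..y}"
    then obtain s where s: "v = q s" "x \<le> s" "s \<le> y" by auto
    then have "s \<in> S" using sub by auto
    then show "v \<in> {q y..q x}" using s assms by (auto simp: q_le)
  qed
qed

lemma p_image:
  assumes "x \<in> S" "y \<in> S" "x \<le> y" shows "p ` {x..y} = {p x..p y}"
proof -
  have sub: "{x..y} \<subseteq> S" using S_below[OF assms(2)] S_D[OF assms(1)] by auto
  show ?thesis
  proof (intro equalityI subsetI)
    fix v assume "v \<in> {p x..p y}"
    then obtain s where "x \<le> s" "s \<le> y" "p s = v"
      using IVT'[of p x v y] assms(3) continuous_on_subset[OF p_continuous sub] by auto
    then show "v \<in> p ` {x..y}" by auto
  next
    fix v assume "v \<in> p ` {x..y}"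
    then obtain s where s: "v = p s" "x \<le> s" "s \<le> y" by auto
    then have "s \<in> S" using sub by auto
    then show "v \<in> {p x..p y}" using s assms by (auto simp: p_le)
  qed
qed

end

section \<open>The transition function\<close>

text \<open>The relays of all admissible pairs, and their superposition with a continuous weight.\<close>

locale transition_experiment = transversal_families +
  fixes \<Gamma> :: "(real^2) set" and w :: "real \<Rightarrow> real \<Rightarrow> real"
    and R :: "real \<Rightarrow> real \<Rightarrow> signal \<Rightarrow> real \<Rightarrow> nat" and t0 :: real
  assumes \<Omega>_open: "open \<Omega>"
    and relay: "\<And>c0 c1. admissible \<Omega> D C c0 c1 \<Longrightarrow>
          relay_operator \<Omega> \<Gamma> t0 (relay_sets D c0 c1) (R c0 c1)"
    and w_cont: "continuous_on (C 0 \<times> C 1) (\<lambda>(c0, c1). w c0 c1)"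
    and starts_off: "\<And>u c0 c1. enters_through \<Omega> \<Gamma> t0 u \<Longrightarrow> admissible \<Omega> D C c0 c1 \<Longrightarrow>
          R c0 c1 u (entrance_time \<Omega> t0 u) = 0"
    and \<Gamma>: "\<Gamma> \<subseteq> frontier \<Omega>" and start_\<Gamma>: "k a \<in> \<Gamma>"
    and defined: "\<And>s0 s1 u t' t''. s0 \<in> S \<Longrightarrow> s1 \<in> S \<Longrightarrow> s0 > s1 \<Longrightarrow>
          first_order_input \<Omega> \<Gamma> t0 I k s0 s1 u t' t'' \<Longrightarrow>
          hysteresis_defined \<Omega> D C w R u t' \<and> hysteresis_defined \<Omega> D C w R u t''"
begin

lemma \<Gamma>_outside: "x \<in> \<Gamma> \<Longrightarrow> x \<notin> \<Omega>"
  using \<Gamma> \<Omega>_open by (auto simp: frontier_def interior_open)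

text \<open>
  The relay \<open>(p x, q y)\<close> at the top and at the end of a first-order input behaves as the Preisach
  relay with thresholds \<open>y < x\<close> on the arc-length parameter.
\<close>

lemma relay_outputs:
  assumes inp: "first_order_input \<Omega> \<Gamma> t0 I k s0 s1 u t' t''"
    and S: "s0 \<in> S" "x \<in> S" "y \<in> S" "y < x"
  shows "R (p x) (q y) u t' = of_bool (x \<le> s0)"
    "R (p x) (q y) u t'' = of_bool (x \<le> s0 \<and> y < s1)"
proof -
  define te where "te = entrance_time \<Omega> t0 u"
  from inp obtain \<sigma> where enters: "enters_through \<Omega> \<Gamma> t0 u" and t: "t0 < t'" "t' < t''"
    and \<sigma>: "continuous_on {t0..} \<sigma>" "\<And>t. t \<ge> t0 \<Longrightarrow> \<sigma> t \<in> I \<and> u t = k (\<sigma> t)"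
    and mono: "strict_mono_on {t0..t'} \<sigma>" "strict_antimono_on {t'..t''} \<sigma>"
    and ends: "\<sigma> t' = s0" "\<sigma> t'' = s1"
    unfolding first_order_input_def by blast
  have in\<Omega>: "u t' \<in> \<Omega>" using \<sigma>(2)[of t'] t ends S_D[OF S(1)] by simp
  define B where "B = {t. t > t0 \<and> u t \<notin> UNIV - closure \<Omega>}"
  have "t' \<in> B" using in\<Omega> t closure_subset by (auto simp: B_def)
  moreover have "bdd_below B" by (auto simp: B_def intro!: bdd_belowI[of _ t0])
  ultimately have "te \<le> t'" "t0 \<le> te"
    unfolding te_def entrance_time_def B_def[symmetric]
    by (auto intro!: cInf_lower cInf_greatest simp: B_def)
  have "u te \<in> \<Gamma>" using enters by (simp add: enters_through_def te_def)
  then have out: "u te \<notin> \<Omega>" by (rule \<Gamma>_outside)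
  then have "te < t'" using in\<Omega> \<open>te \<le> t'\<close> by (cases "te = t'") auto
  have "\<sigma> te \<notin> S" using out S_D \<sigma>(2)[OF \<open>t0 \<le> te\<close>] by auto
  then have "\<sigma> te \<le> a" using \<sigma>(2)[OF \<open>t0 \<le> te\<close>]
    unfolding S_eq(2) by auto
  then have low: "\<sigma> te < y" using S_D[OF S(3)] by simp
  have adm: "admissible \<Omega> D C (p x) (q y)" using admissible_iff S by simp
  have ev: "relay_evolution \<Omega> (relay_sets D (p x) (q y)) u te (R (p x) (q y) u)"
    using relay[OF adm] enters by (simp add: relay_operator_def te_def)
  have contact: "u t \<in> rel_boundary \<Omega> (relay_sets D (p x) (q y) 0) \<longleftrightarrow> \<sigma> t = x"
    "u t \<in> rel_boundary \<Omega> (relay_sets D (p x) (q y) 1) \<longleftrightarrow> \<sigma> t = y" if "te \<le> t" for t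
    using contact_iff[of 0 x "\<sigma> t"] contact_iff[of 1 y "\<sigma> t"] S \<sigma>(2)[of t] that \<open>t0 \<le> te\<close>
    by (auto simp: relay_sets_def p_def q_def)
  have "R (p x) (q y) u te = 0" unfolding te_def by (rule starts_off[OF enters adm])
  from relay_up_down[OF ev this \<open>te < t'\<close> t(2) _ _ mono(2) contact _ low, unfolded ends]
  show "R (p x) (q y) u t' = of_bool (x \<le> s0)"
    "R (p x) (q y) u t'' = of_bool (x \<le> s0 \<and> y < s1)"
    using \<open>t0 \<le> te\<close> S(4) continuous_on_subset[OF \<sigma>(1), of "{te..t''}"]
      monotone_on_subset[OF mono(1), of "{te..t'}"] by auto
qed

text \<open>
  The relays that are on at the top \<open>s0\<close> and off after the decrease to \<open>s1\<close>.  In the coordinates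
  \<open>(p x, q y)\<close> this is the triangle \<open>s1 \<le> y < x \<le> s0\<close>; it is written with the bounds on the second
  parameter as the outer ones, since then \<open>s1\<close> enters only there.
\<close>

definition triangle :: "real \<Rightarrow> real \<Rightarrow> (real \<times> real) set" where
  "triangle s0 s1 = {(c0, c1). q s0 \<le> c1 \<and> c1 \<le> q s1 \<and> p (qinv c1) < c0 \<and> c0 \<le> p s0}"

lemma triangle_iff:
  assumes "s0 \<in> S" "s1 \<in> S" "x \<in> S" "y \<in> S" "y < x"
  shows "(p x, q y) \<in> triangle s0 s1 \<longleftrightarrow> x \<le> s0 \<and> s1 \<le> y"
  using assms by (auto simp: triangle_def q_le p_le p_less qinv_q)

lemma triangle_admissible:
  assumes "s0 \<in> S" "s1 \<in> S" "s1 \<le> s0"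
  shows "triangle s0 s1 \<subseteq> admissible_pairs \<Omega> D C"
proof
  fix z assume "z \<in> triangle s0 s1"
  then obtain c0 c1 where z: "z = (c0, c1)"
    and c1: "c1 \<in> {q s0..q s1}" and c0: "p (qinv c1) < c0" "c0 \<le> p s0"
    by (auto simp: triangle_def)
  from c1 obtain y where y: "s1 \<le> y" "y \<le> s0" "c1 = q y"
    using q_image[OF assms(2,1,3)] by (metis (no_types, lifting) atLeastAtMost_iff imageE)
  then have yS: "y \<in> S" using S_below[OF assms(1)] S_D[OF assms(2)] by simp
  have "c0 \<in> {p y..p s0}" using c0 by (simp add: y(3) qinv_q[OF yS])
  then obtain x where x: "y \<le> x" "x \<le> s0" "c0 = p x"
    using p_image[OF yS assms(1) y(2)] by (metis (no_types, lifting) atLeastAtMost_iff imageE)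
  then have xS: "x \<in> S" using S_below[OF assms(1)] S_D[OF yS] by simp
  have "y < x" using c0(1) by (simp add: x(3) y(3) qinv_q[OF yS] p_less[OF yS xS])
  then show "z \<in> admissible_pairs \<Omega> D C"
    by (simp add: z x(3) y(3) admissible_pairs_def admissible_iff[OF xS yS])
qed

text \<open>
  The drop of the output is the same for all first-order inputs with turning point \<open>s0\<close> and end
  point \<open>s1\<close>, so that the transition function is well defined.
\<close>

lemma output_drop:
  assumes inp: "first_order_input \<Omega> \<Gamma> t0 I k s0 s1 u t' t''"
    and S: "s0 \<in> S" "s1 \<in> S" "s1 < s0"
  shows "set_integrable lborel (triangle s0 s1) (\<lambda>(c0, c1). w c0 c1)"
    "hysteresis \<Omega> D C w R u t' - hysteresis \<Omega> D C w R u t''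
      = (LINT z:triangle s0 s1|lborel. (case z of (c0, c1) \<Rightarrow> w c0 c1))"
proof -
  define f where "f t z = (case z of (c0, c1) \<Rightarrow> w c0 c1 * real (R c0 c1 u t))" for t z
  have drop: "indicator (admissible_pairs \<Omega> D C) z *\<^sub>R (f t' z - f t'' z)
      = indicator (triangle s0 s1) z *\<^sub>R (case z of (c0, c1) \<Rightarrow> w c0 c1)" for z
  proof (cases "z \<in> admissible_pairs \<Omega> D C")
    case True
    then obtain x y where xy: "x \<in> S" "y \<in> S" "y < x" "z = (p x, q y)"
      by (auto simp: admissible_pairs_def elim: admissibleE)
    show ?thesis
      using True by (auto simp: xy(4) f_def triangle_iff[OF S(1,2) xy(1-3)]
          relay_outputs[OF inp S(1) xy(1-3)] indicator_def)
  next
    case False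
    then have "z \<notin> triangle s0 s1" using triangle_admissible[OF S(1,2)] S(3) by auto
    then show ?thesis using False by simp
  qed
  have int: "set_integrable lborel (admissible_pairs \<Omega> D C) (f t')"
    "set_integrable lborel (admissible_pairs \<Omega> D C) (f t'')"
    using defined[OF S inp] by (auto simp: hysteresis_defined_def f_def[abs_def])
  show "set_integrable lborel (triangle s0 s1) (\<lambda>(c0, c1). w c0 c1)"
    using set_integral_diff(1)[OF int] by (simp only: set_integrable_def drop)
  have "(LINT z:admissible_pairs \<Omega> D C|lborel. f t' z)
        - (LINT z:admissible_pairs \<Omega> D C|lborel. f t'' z)
      = (LINT z:triangle s0 s1|lborel. (case z of (c0, c1) \<Rightarrow> w c0 c1))"
    unfolding set_integral_diff(2)[OF int, symmetric] by (simp only: set_lebesgue_integral_def drop)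
  then show "hysteresis \<Omega> D C w R u t' - hysteresis \<Omega> D C w R u t''
      = (LINT z:triangle s0 s1|lborel. (case z of (c0, c1) \<Rightarrow> w c0 c1))"
    by (simp add: hysteresis_def f_def[abs_def])
qed

lemma first_order_input_exists:
  assumes S: "s0 \<in> S" "s1 \<in> S" "s1 < s0"
  shows "\<exists>u t' t''. first_order_input \<Omega> \<Gamma> t0 I k s0 s1 u t' t''"
proof -
  note s0 = S_D[OF S(1)] and s1 = S_D[OF S(2)]
  \<comment> \<open>Linear from \<open>a\<close> to \<open>s0\<close> in unit time, then linear down to \<open>s1\<close> in unit time, then constant.\<close>
  define \<sigma> where
    "\<sigma> t = min (a + (t - t0) * (s0 - a)) (max s1 (s0 - (t - (t0 + 1)) * (s0 - s1)))" for t
  define u where "u = k \<circ> \<sigma>"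
  have up: "\<sigma> t = a + (t - t0) * (s0 - a)" if "t \<in> {t0..t0 + 1}" for t
  proof -
    have "(t - t0) * (s0 - a) \<le> 1 * (s0 - a)" using that s0 by (intro mult_right_mono) auto
    moreover have "(t - (t0 + 1)) * (s0 - s1) \<le> 0"
      using that S(3) by (intro mult_nonpos_nonneg) auto
    ultimately show ?thesis unfolding \<sigma>_def by simp
  qed
  have over: "\<sigma> t = max s1 (s0 - (t - (t0 + 1)) * (s0 - s1))" if "t \<ge> t0 + 1" for t
  proof -
    have "1 * (s0 - a) \<le> (t - t0) * (s0 - a)" using that s0 by (intro mult_right_mono) auto
    moreover have "(t - (t0 + 1)) * (s0 - s1) \<ge> 0"
      using that S(3) by (intro mult_nonneg_nonneg) auto
    ultimately show ?thesis using S(3) unfolding \<sigma>_def by simp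
  qed
  have down: "\<sigma> t = s0 - (t - (t0 + 1)) * (s0 - s1)" if "t \<in> {t0 + 1..t0 + 2}" for t
  proof -
    have "(t - (t0 + 1)) * (s0 - s1) \<le> 1 * (s0 - s1)"
      using that S(3) by (intro mult_right_mono) auto
    then show ?thesis using over[of t] that by simp
  qed
  have inS: "\<sigma> t \<in> S" if "t > t0" for t
  proof -
    have "a < a + (t - t0) * (s0 - a)" using that s0 by simp
    then have "a < \<sigma> t" using s1 unfolding \<sigma>_def by (simp add: less_max_iff_disj)
    moreover have "\<sigma> t \<le> s0"
    proof (cases "t \<le> t0 + 1")
      case True
      have "(t - t0) * (s0 - a) \<le> 1 * (s0 - a)" using that True s0 by (intro mult_right_mono) auto
      then show ?thesis using up[of t] that True by simp
    next
      case False
      then have "(t - (t0 + 1)) * (s0 - s1) \<ge> 0" using S(3) by (intro mult_nonneg_nonneg) auto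
      then show ?thesis using over[of t] False S(3) by simp
    qed
    ultimately show ?thesis using S_below[OF S(1)] by simp
  qed
  have at_start: "\<sigma> t0 = a" using up[of t0] by simp
  have inI: "\<sigma> t \<in> I" if "t \<ge> t0" for t
    using inS[of t] at_start start S_D that by (cases "t = t0") auto
  have cont\<sigma>: "continuous_on {t0..} \<sigma>" unfolding \<sigma>_def by (intro continuous_intros)
  have contu: "continuous_on {t0..} u"
    unfolding u_def using inI
    by (intro continuous_on_compose cont\<sigma> continuous_on_subset[OF k_continuous]) auto
  \<comment> \<open>The signal starts on the boundary and enters at once.\<close>
  have "{t. t > t0 \<and> u t \<notin> UNIV - closure \<Omega>} = {t0<..}"
    using inS S_D closure_subset[of \<Omega>] by (auto simp: u_def)
  then have te: "entrance_time \<Omega> t0 u = t0" by (simp add: entrance_time_def)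
  have "enters_through \<Omega> \<Gamma> t0 u"
    unfolding enters_through_def te using contu start_\<Gamma> \<Gamma>_outside[OF start_\<Gamma>] inS S_D
    by (auto simp: u_def at_start)
  moreover have "strict_mono_on {t0..t0 + 1} \<sigma>"
    using s0 by (intro strict_mono_onI) (simp add: up del: atLeastAtMost_iff)
  moreover have "strict_antimono_on {t0 + 1..t0 + 2} \<sigma>"
    using S(3) by (intro monotone_onI) (simp add: down del: atLeastAtMost_iff)
  moreover have "\<sigma> (t0 + 1) = s0" "\<sigma> (t0 + 2) = s1"
    using up[of "t0 + 1"] down[of "t0 + 2"] by auto
  ultimately have "first_order_input \<Omega> \<Gamma> t0 I k s0 s1 u (t0 + 1) (t0 + 2)"
    unfolding first_order_input_def using cont\<sigma> inI by (auto simp: u_def intro!: exI[of _ \<sigma>])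
  then show ?thesis by blast
qed

abbreviation \<psi> :: "real \<Rightarrow> real \<Rightarrow> real" where
  "\<psi> \<equiv> transition_fun \<Omega> \<Gamma> D C w R t0 I k"

lemma rectangle:
  assumes "x \<in> S" "y \<in> S" "x \<le> y"
  shows "{p x..p y} \<subseteq> C 0" "{q y..q x} \<subseteq> C 1"
proof -
  have "{x..y} \<subseteq> S" using S_below[OF assms(2)] S_D[OF assms(1)] by auto
  then show "{p x..p y} \<subseteq> C 0" "{q y..q x} \<subseteq> C 1"
    using p_mem q_mem unfolding p_image[OF assms, symmetric] q_image[OF assms, symmetric] by auto
qed

lemma pq_continuous:
  assumes "x \<in> S" "y \<in> S" "x \<le> y"
  shows "continuous_on {q y..q x} (\<lambda>v. p (qinv v))"
    "\<And>v. v \<in> {q y..q x} \<Longrightarrow> p x \<le> p (qinv v) \<and> p (qinv v) \<le> p y"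
proof -
  have sub: "{x..y} \<subseteq> S" using S_below[OF assms(2)] S_D[OF assms(1)] by auto
  then have inv: "qinv (q s) = s" if "s \<in> {x..y}" for s using qinv_q that by blast
  have "continuous_on (q ` {x..y}) qinv"
    using continuous_on_subset[OF q_continuous sub] inv by (intro continuous_on_inv) auto
  moreover have img: "qinv ` (q ` {x..y}) = {x..y}" using inv by (force simp: image_image)
  ultimately show "continuous_on {q y..q x} (\<lambda>v. p (qinv v))"
    unfolding q_image[OF assms, symmetric]
    using continuous_on_subset[OF p_continuous sub]
    by (intro continuous_on_compose2[of "{x..y}" p _ qinv]) auto
  fix v assume "v \<in> {q y..q x}"
  then have "qinv v \<in> {x..y}" unfolding q_image[OF assms, symmetric] using img by blast
  then show "p x \<le> p (qinv v) \<and> p (qinv v) \<le> p y" using sub assms p_le by auto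
qed

lemma w_continuous:
  assumes "x \<in> S" "y \<in> S" "x \<le> y" "b \<in> S" "d \<in> S" "b \<le> d"
  shows "continuous_on ({p x..p y} \<times> {q d..q b}) (\<lambda>(c0, c1). w c0 c1)"
  using rectangle(1)[OF assms(1-3)] rectangle(2)[OF assms(4-6)]
  by (intro continuous_on_subset[OF w_cont]) blast

lemma transition_fun_eq:
  assumes S: "s0 \<in> S" "s1 \<in> S" "s1 < s0"
  shows "\<psi> s0 s1 = integral {q s0..q s1} (\<lambda>v. integral {p (qinv v)..p s0} (\<lambda>u. w u v))"
proof -
  obtain u t' t'' where inp: "first_order_input \<Omega> \<Gamma> t0 I k s0 s1 u t' t''"
    using first_order_input_exists[OF S] by blast
  have "\<psi> s0 s1 = (LINT z:triangle s0 s1|lborel. (case z of (c0, c1) \<Rightarrow> w c0 c1))"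
    unfolding transition_fun_def
  proof (rule the_equality)
    show "\<exists>u t' t''. first_order_input \<Omega> \<Gamma> t0 I k s0 s1 u t' t'' \<and>
        (LINT z:triangle s0 s1|lborel. (case z of (c0, c1) \<Rightarrow> w c0 c1))
          = hysteresis \<Omega> D C w R u t' - hysteresis \<Omega> D C w R u t''"
      using inp output_drop(2)[OF inp S] by metis
  qed (use output_drop(2)[OF _ S] in blast)
  also have "\<dots> = integral {q s0..q s1} (\<lambda>v. integral {p (qinv v)..p s0} (\<lambda>u. w u v))"
    unfolding triangle_def
    by (rule integral_below_upper_bound[where A = "p s1"])
      (use S w_continuous[of s1 s0 s1 s0] pq_continuous[of s1 s0] output_drop(1)[OF inp S]
        in \<open>auto simp: triangle_def\<close>)
  finally show ?thesis .
qed

lemma transition_fun_deriv: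
  assumes S: "s0 \<in> S" "s1 \<in> S" "s1 < s0"
  shows "((\<lambda>y. \<psi> s0 y) has_real_derivative deriv q s1 * integral {p s1..p s0} (\<lambda>u. w u (q s1)))
    (at s1)"
proof -
  \<comment> \<open>Any parameter of \<open>S\<close> below \<open>s1\<close> would do; it gives room to vary \<open>s1\<close> on both sides.\<close>
  define b where "b = (a + s1) / 2"
  have ab: "a < b" "b < s1" using S_D[OF S(2)] by (auto simp: b_def)
  then have b: "b \<in> S" using S_below[OF S(2)] by simp
  define g where "g v = integral {p (qinv v)..p s0} (\<lambda>u. w u v)" for v
  have "continuous_on {q s0..q b} g"
    unfolding g_def using b S ab
    by (intro continuous_on_integral_lower_limit[where A = "p b"] w_continuous pq_continuous) auto
  then have "((\<lambda>y. integral {q s0..q y} g) has_real_derivative deriv q s1 * g (q s1)) (at s1)"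
    using b S ab by (intro integral_upper_limit_has_derivative[where d = "q b"] q_deriv)
      (auto simp: q_less)
  then have deriv: "((\<lambda>y. integral {q s0..q y} g) has_real_derivative
      deriv q s1 * integral {p s1..p s0} (\<lambda>u. w u (q s1))) (at s1)"
    by (simp add: g_def qinv_q S)
  have "integral {q s0..q y} g = \<psi> s0 y" if "y \<in> {b<..<s0}" for y
    using that S_below[OF S(1), of y] transition_fun_eq[OF S(1), of y] ab
    by (simp add: g_def[abs_def])
  then show ?thesis
    by (intro has_field_derivative_transform_within_open[OF deriv, of "{b<..<s0}"])
      (use S ab in auto)
qed

text \<open>
  The derivative in \<open>s1\<close> depends on \<open>s0\<close> only through the upper limit of an integral, whose
  integrand is the weight along the line \<open>c1 = q s1\<close>.
\<close>

lemma transition_fun_mixed_partial: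
  assumes S: "s0 \<in> S" "s1 \<in> S" "s1 < s0"
  shows "has_mixed_partial \<psi> (deriv p s0 * deriv q s1 * w (p s0) (q s1)) s0 s1"
proof -
  obtain r where r: "r > 0" "ball s0 r \<subseteq> S" using open_S S(1) by (auto simp: open_contains_ball)
  define e where "e = s0 + r / 2"
  have e: "e \<in> S" "s0 < e" using r by (auto simp: e_def dist_real_def intro!: subsetD[OF r(2)])
  define G where "G x = integral {p s1..p x} (\<lambda>u. w u (q s1))" for x
  have "continuous_on {p s1..p e} (\<lambda>u. (\<lambda>(c0, c1). w c0 c1) (u, q s1))"
    by (rule continuous_on_compose2[OF w_continuous[of s1 e s1 s1]])
      (use S e in \<open>auto intro!: continuous_intros\<close>)
  then have "(G has_real_derivative deriv p s0 * w (p s0) (q s1)) (at s0)"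
    unfolding G_def using S e
    by (intro integral_upper_limit_has_derivative[where d = "p e"] p_deriv) (auto simp: p_less)
  then have "((\<lambda>x. deriv q s1 * G x) has_real_derivative
      deriv q s1 * (deriv p s0 * w (p s0) (q s1))) (at s0)"
    by (rule DERIV_cmult)
  moreover have "\<forall>\<^sub>F x in nhds s0.
      ((\<lambda>y. \<psi> x y) has_real_derivative deriv q s1 * G x) (at s1)"
  proof -
    have "open (S \<inter> {s1<..})" "s0 \<in> S \<inter> {s1<..}" using open_S S by auto
    then have "\<forall>\<^sub>F x in nhds s0. x \<in> S \<inter> {s1<..}" by (rule eventually_nhds_in_open)
    then show ?thesis
      by eventually_elim (use transition_fun_deriv S in \<open>auto simp: G_def\<close>)
  qed
  ultimately show ?thesis
    unfolding has_mixed_partial_def by (intro exI[of _ "\<lambda>x. deriv q s1 * G x"]) (simp add: ac_simps)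
qed

end

section \<open>Identification of the weight\<close>

theorem theorem5p2:
  fixes \<Omega> \<Gamma> :: "(real^2) set"
    and D :: "nat \<Rightarrow> real \<Rightarrow> (real^2) set"
    and C :: "nat \<Rightarrow> real set"
    and w :: "real \<Rightarrow> real \<Rightarrow> real"
    and R :: "real \<Rightarrow> real \<Rightarrow> signal \<Rightarrow> real \<Rightarrow> nat"
    and t0 :: real
    and I S :: "real set" and k :: "real \<Rightarrow> real^2" and a :: real
  assumes \<Omega>_open: "open \<Omega>"
    and D_open: "\<And>i c. i < 2 \<Longrightarrow> c \<in> C i \<Longrightarrow> open (D i c) \<and> D i c \<subseteq> \<Omega>"
    and \<gamma>_curve: "\<And>i c. i < 2 \<Longrightarrow> c \<in> C i \<Longrightarrow> continuous_curve (rel_boundary \<Omega> (D i c))"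
    and relay: "\<And>c0 c1. admissible \<Omega> D C c0 c1 \<Longrightarrow>
          relay_operator \<Omega> \<Gamma> t0 (relay_sets D c0 c1) (R c0 c1)"
    and w_cont: "continuous_on (C 0 \<times> C 1) (\<lambda>(c0, c1). w c0 c1)"
    and c1: "\<And>i x. i < 2 \<Longrightarrow> x \<in> \<Omega> \<Longrightarrow> \<exists>!c. c \<in> C i \<and> x \<in> rel_boundary \<Omega> (D i c)"
    and c2: "\<And>i c c'. i < 2 \<Longrightarrow> c \<in> C i \<Longrightarrow> c' \<in> C i \<Longrightarrow> c \<noteq> c' \<Longrightarrow>
          (D i c \<subset> D i c') \<noteq> (D i c' \<subset> D i c)"
    and c3: "\<And>i c c'. i < 2 \<Longrightarrow> c \<in> C i \<Longrightarrow> c' \<in> C i \<Longrightarrow> D i c \<subset> D i c' \<Longrightarrow> c < c'"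
    and c4: "\<And>x x'. x \<in> \<Omega> \<Longrightarrow> x' \<in> \<Omega> \<Longrightarrow>
          param \<Omega> D C 0 x < param \<Omega> D C 0 x' \<longleftrightarrow> param \<Omega> D C 1 x > param \<Omega> D C 1 x'"
    and P1: "frontier \<Omega> \<noteq> {}"
    and P2_\<Gamma>: "\<Gamma> \<subseteq> frontier \<Omega>"
    and P2: "\<And>u c0 c1. enters_through \<Omega> \<Gamma> t0 u \<Longrightarrow> admissible \<Omega> D C c0 c1 \<Longrightarrow>
          R c0 c1 u (entrance_time \<Omega> t0 u) = 0"
    and P3_curve: "arc_length_curve I k"
    and P3_\<Gamma>: "a \<in> I" "k a \<in> \<Gamma>"
    and S: "S = {s \<in> I. k s \<in> \<Omega>}" "S = {s \<in> I. a < s}"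
    and P3_point: "\<And>i c. i < 2 \<Longrightarrow> c \<in> C i \<Longrightarrow>
          \<exists>!x. x \<in> k ` I \<and> x \<in> rel_boundary \<Omega> (D i c)"
    and P3_transversal: "\<And>i c s. i < 2 \<Longrightarrow> c \<in> C i \<Longrightarrow> s \<in> I \<Longrightarrow>
          k s \<in> rel_boundary \<Omega> (D i c) \<Longrightarrow> crosses_at \<Omega> (D i c) I k s"
    and P4: "\<And>P P'. P \<in> k ` I \<inter> \<Omega> \<Longrightarrow> P' \<in> k ` I \<inter> \<Omega> \<Longrightarrow>
          param \<Omega> D C 0 P < param \<Omega> D C 0 P' \<Longrightarrow>
          admissible \<Omega> D C (param \<Omega> D C 0 P') (param \<Omega> D C 1 P)"
    and P5: "\<And>s s'. s \<in> S \<Longrightarrow> s' \<in> S \<Longrightarrow> curve_less \<Omega> D C I k (k s) (k s') \<longleftrightarrow> s < s'"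
    and P6_C1: "(\<lambda>s. param \<Omega> D C 0 (k s)) C1_differentiable_on S"
               "(\<lambda>s. param \<Omega> D C 1 (k s)) C1_differentiable_on S"
    and P6_J: "\<And>s0 s1. s0 \<in> S \<Longrightarrow> s1 \<in> S \<Longrightarrow> s0 > s1 \<Longrightarrow> J_fun \<Omega> D C k s0 s1 \<noteq> 0"
    and H_defined: "\<And>s0 s1 u t' t''. s0 \<in> S \<Longrightarrow> s1 \<in> S \<Longrightarrow> s0 > s1 \<Longrightarrow>
          first_order_input \<Omega> \<Gamma> t0 I k s0 s1 u t' t'' \<Longrightarrow>
          hysteresis_defined \<Omega> D C w R u t' \<and> hysteresis_defined \<Omega> D C w R u t''"
  shows "(\<forall>s0\<in>S. \<forall>s1\<in>S. s0 > s1 \<longrightarrow>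
            (\<exists>d. has_mixed_partial (transition_fun \<Omega> \<Gamma> D C w R t0 I k) d s0 s1 \<and>
                 W_fun \<Omega> D C w (k s0) (k s1) = - (1 / J_fun \<Omega> D C k s0 s1) * d)) \<and>
         (\<forall>c0 c1. admissible \<Omega> D C c0 c1 \<longrightarrow>
            curve_less \<Omega> D C I k (crossing_point \<Omega> D I k 1 c1) (crossing_point \<Omega> D I k 0 c0) \<and>
            w c0 c1 = W_fun \<Omega> D C w (crossing_point \<Omega> D I k 0 c0) (crossing_point \<Omega> D I k 1 c1))"
proof -
  interpret transition_experiment \<Omega> D C I S k a \<Gamma> w R t0
    by (unfold_locales; fact assms)
  have formula: "\<exists>d. has_mixed_partial (transition_fun \<Omega> \<Gamma> D C w R t0 I k) d s0 s1 \<and>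
      W_fun \<Omega> D C w (k s0) (k s1) = - (1 / J_fun \<Omega> D C k s0 s1) * d"
    if "s0 \<in> S" "s1 \<in> S" "s1 < s0" for s0 s1
  proof -
    have "J_fun \<Omega> D C k s0 s1 \<noteq> 0" by (rule P6_J[OF that])
    then have "W_fun \<Omega> D C w (k s0) (k s1)
        = - (1 / J_fun \<Omega> D C k s0 s1) * (deriv p s0 * deriv q s1 * w (p s0) (q s1))"
      unfolding J_eq[OF that(1,2)] by (simp add: W_fun_def p_def q_def)
    then show ?thesis using transition_fun_mixed_partial[OF that] by blast
  qed
  have recovery: "curve_less \<Omega> D C I k (crossing_point \<Omega> D I k 1 c1) (crossing_point \<Omega> D I k 0 c0) \<and>
      w c0 c1 = W_fun \<Omega> D C w (crossing_point \<Omega> D I k 0 c0) (crossing_point \<Omega> D I k 1 c1)"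
    if "admissible \<Omega> D C c0 c1" for c0 c1
    using that by (rule admissibleE) (simp add: curve_less W_fun_def p_def q_def)
  show ?thesis using formula recovery by blast
qed

end
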